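(* Let $\mathcal{A}$ be a Banach algebra with a bounded approximate identity and let $\sigma\in Hom(\mathcal{A})$. If $\mathcal{A}$ is $\sigma$-biflat, then $\mathcal{A}$ has a $\sigma$-virtual diagonal.
   Context: $Hom(\mathcal{A})$ is the set of all continuous algebra homomorphisms $\mathcal{A}\to\mathcal{A}$. The projective tensor product $\mathcal{A}\widehat{\otimes}\mathcal{A}$ is a Banach $\mathcal{A}$-bimodule via $a\cdot(b\otimes c)=ab\otimes c$ and $(b\otimes c)\cdot a=b\otimes ca$. The diagonal operator is $\pi:\mathcal{A}\widehat{\otimes}\mathcal{A}\to\mathcal{A}$, $\pi(a\otimes b)=ab$. For a Banach $\mathcal{A}$-bimodule $X$, the dual $X^*$ is a Banach $\mathcal{A}$-bimodule via $\langle a\cdot\lambda,x\rangle=\langle\lambda,x\cdot a\rangle$ and $\langle\lambda\cdot a,x\rangle=\langle\lambda,a\cdot x\rangle$; biduals are bimodules by iterating this. $\mathcal{A}$ is $\sigma$-biflat if there exists a bounded linear map $\rho:(\mathcal{A}\widehat{\otimes}\mathcal{A})^*\to\mathcal{A}^*$ such that $\rho(\sigma(a)\cdot\lambda)=a\cdot\rho(\lambda)$ and $\rho(\lambda\cdot\sigma(a))=\rho(\lambda)\cdot a$ for all $a\in\mathcal{A}$, $\lambda\in(\mathcal{A}\widehat{\otimes}\mathcal{A})^*$, and $\rho\circ\pi^*=\sigma^*$. An element $M\in(\mathcal{A}\widehat{\otimes}\mathcal{A})^{**}$ is a $\sigma$-virtual diagonal for $\mathcal{A}$ if $\sigma(a)\cdot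 M=M\cdot\sigma(a)$ and $\pi^{**}(M)\cdot\sigma(a)=\sigma(a)$ for all $a\in\mathcal{A}$, where $\mathcal{A}$ is identified with its canonical image in $\mathcal{A}^{**}$. *)

theory Defs
  imports "HOL-Analysis.Analysis" "HOL-Library.Poly_Mapping"
begin

section \<open>Complex Banach spaces and Banach algebras\<close>

class scaleC =
  fixes scaleC :: "complex \<Rightarrow> 'a \<Rightarrow> 'a"  (infixr \<open>*\<^sub>C\<close> 75)

class complex_vector = scaleC + real_vector +
  assumes scaleC_add_right: "c *\<^sub>C (x + y) = c *\<^sub>C x + c *\<^sub>C y"
    and scaleC_add_left: "(c + d) *\<^sub>C x = c *\<^sub>C x + d *\<^sub>C x"
    and scaleC_scaleC: "c *\<^sub>C d *\<^sub>C x = (c * d) *\<^sub>C x"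
    and scaleC_of_real: "complex_of_real r *\<^sub>C x = r *\<^sub>R x"

class complex_normed_vector = complex_vector + real_normed_vector +
  assumes norm_scaleC: "norm (c *\<^sub>C x) = cmod c * norm x"

class complex_banach = complex_normed_vector + banach

text \<open>No unit is required.\<close>

class complex_banach_algebra = complex_banach + real_normed_algebra +
  assumes mult_scaleC_left: "(c *\<^sub>C x) * y = c *\<^sub>C (x * y)"
    and mult_scaleC_right: "x * (c *\<^sub>C y) = c *\<^sub>C (x * y)"

lemma scaleC_one [simp]: "1 *\<^sub>C (x::'a::complex_vector) = x"
  using scaleC_of_real[of 1 x] by simp

interpretation complex_vector: vector_space "scaleC :: complex \<Rightarrow> 'a \<Rightarrow> 'a::complex_vector"
  by standard (simp_all add: scaleC_add_right scaleC_add_left scaleC_scaleC)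

instantiation complex :: complex_banach_algebra
begin

definition scaleC_complex :: "complex \<Rightarrow> complex \<Rightarrow> complex"
  where "scaleC_complex c z = c * z"

instance
  by standard
    (simp_all add: scaleC_complex_def algebra_simps norm_mult scaleR_conv_of_real)

end


section \<open>Bounded operators, dual spaces, adjoints\<close>

definition bounded_clinear :: "('a::complex_normed_vector \<Rightarrow> 'b::complex_normed_vector) \<Rightarrow> bool"
  where "bounded_clinear f \<longleftrightarrow> bounded_linear f \<and> (\<forall>c x. f (c *\<^sub>C x) = c *\<^sub>C f x)"

typedef (overloaded) ('a, 'b) cblinfun  (infixr \<open>\<Rightarrow>\<^bsub>CL\<^esub>\<close> 21) =
  "{f :: 'a::complex_normed_vector \<Rightarrow> 'b::complex_normed_vector. bounded_clinear f}"
  morphisms cblinfun_apply CBlinfun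
  by (rule exI[of _ "\<lambda>_. 0"]) (simp add: bounded_clinear_def)

notation cblinfun_apply  (infixr \<open>*\<^sub>V\<close> 70)

setup_lifting type_definition_cblinfun

lemma cblinfun_eqI: "(\<And>x. f *\<^sub>V x = g *\<^sub>V x) \<Longrightarrow> f = g"
  by transfer auto

lemma bounded_clinear_apply: "bounded_clinear (cblinfun_apply f)"
  using cblinfun_apply by blast

lemma bounded_linear_cblinfun_apply: "bounded_linear (cblinfun_apply f)"
  using bounded_clinear_apply bounded_clinear_def by blast

lemma cblinfun_scaleC_right: "f *\<^sub>V (c *\<^sub>C x) = c *\<^sub>C (f *\<^sub>V x)"
  using bounded_clinear_apply bounded_clinear_def by blast

lemma onorm_scaleC:
  fixes f :: "'a::complex_normed_vector \<Rightarrow> 'b::complex_normed_vector"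
  assumes "bounded_linear f"
  shows "onorm (\<lambda>x. c *\<^sub>C f x) = cmod c * onorm f"
proof -
  have "onorm (\<lambda>x. c *\<^sub>C f x) = onorm (\<lambda>x. cmod c *\<^sub>R f x)"
    by (simp add: onorm_def norm_scaleC)
  also have "\<dots> = cmod c * onorm f"
    using onorm_scaleR[OF assms, of "cmod c"] by simp
  finally show ?thesis .
qed

lemma bounded_linear_scaleC: "bounded_linear (\<lambda>x. c *\<^sub>C (x::'a::complex_normed_vector))"
proof (rule bounded_linear_intro[where K = "cmod c"])
  fix x y :: 'a and r :: real
  show "c *\<^sub>C (x + y) = c *\<^sub>C x + c *\<^sub>C y" by (rule scaleC_add_right)
  show "c *\<^sub>C r *\<^sub>R x = r *\<^sub>R c *\<^sub>C x"
    by (simp flip: scaleC_of_real add: scaleC_scaleC mult.commute)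
  show "norm (c *\<^sub>C x) \<le> norm x * cmod c" by (simp add: norm_scaleC)
qed

instantiation cblinfun :: (complex_normed_vector, complex_normed_vector) complex_normed_vector
begin

lift_definition norm_cblinfun :: "('a \<Rightarrow>\<^bsub>CL\<^esub> 'b) \<Rightarrow> real" is onorm .

lift_definition zero_cblinfun :: "'a \<Rightarrow>\<^bsub>CL\<^esub> 'b" is "\<lambda>x. 0"
  by (simp add: bounded_clinear_def)

lift_definition plus_cblinfun :: "('a \<Rightarrow>\<^bsub>CL\<^esub> 'b) \<Rightarrow> ('a \<Rightarrow>\<^bsub>CL\<^esub> 'b) \<Rightarrow> 'a \<Rightarrow>\<^bsub>CL\<^esub> 'b" is "\<lambda>f g x. f x + g x"
  by (simp add: bounded_clinear_def bounded_linear_add scaleC_add_right)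

lift_definition minus_cblinfun :: "('a \<Rightarrow>\<^bsub>CL\<^esub> 'b) \<Rightarrow> ('a \<Rightarrow>\<^bsub>CL\<^esub> 'b) \<Rightarrow> 'a \<Rightarrow>\<^bsub>CL\<^esub> 'b" is "\<lambda>f g x. f x - g x"
  by (simp add: bounded_clinear_def bounded_linear_sub complex_vector.scale_right_diff_distrib)

lift_definition uminus_cblinfun :: "('a \<Rightarrow>\<^bsub>CL\<^esub> 'b) \<Rightarrow> 'a \<Rightarrow>\<^bsub>CL\<^esub> 'b" is "\<lambda>f x. - f x"
  by (simp add: bounded_clinear_def bounded_linear_minus)

lift_definition scaleC_cblinfun :: "complex \<Rightarrow> ('a \<Rightarrow>\<^bsub>CL\<^esub> 'b) \<Rightarrow> 'a \<Rightarrow>\<^bsub>CL\<^esub> 'b" is "\<lambda>c f x. c *\<^sub>C f x"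
  by (simp add: bounded_clinear_def bounded_linear_compose[OF bounded_linear_scaleC]
      scaleC_scaleC mult.commute)

definition scaleR_cblinfun :: "real \<Rightarrow> ('a \<Rightarrow>\<^bsub>CL\<^esub> 'b) \<Rightarrow> 'a \<Rightarrow>\<^bsub>CL\<^esub> 'b"
  where "scaleR_cblinfun r f = complex_of_real r *\<^sub>C f"

definition dist_cblinfun :: "('a \<Rightarrow>\<^bsub>CL\<^esub> 'b) \<Rightarrow> ('a \<Rightarrow>\<^bsub>CL\<^esub> 'b) \<Rightarrow> real"
  where "dist_cblinfun f g = norm (f - g)"

definition sgn_cblinfun :: "('a \<Rightarrow>\<^bsub>CL\<^esub> 'b) \<Rightarrow> 'a \<Rightarrow>\<^bsub>CL\<^esub> 'b"
  where "sgn_cblinfun f = inverse (norm f) *\<^sub>R f"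

definition uniformity_cblinfun :: "(('a \<Rightarrow>\<^bsub>CL\<^esub> 'b) \<times> ('a \<Rightarrow>\<^bsub>CL\<^esub> 'b)) filter"
  where "uniformity_cblinfun = (INF e\<in>{0<..}. principal {(f, g). dist f g < e})"

definition open_cblinfun :: "('a \<Rightarrow>\<^bsub>CL\<^esub> 'b) set \<Rightarrow> bool"
  where "open_cblinfun S = (\<forall>f\<in>S. \<forall>\<^sub>F (f', g) in uniformity. f' = f \<longrightarrow> g \<in> S)"

instance
proof
  fix f g h :: "'a \<Rightarrow>\<^bsub>CL\<^esub> 'b" and c d :: complex and r s :: real and U :: "('a \<Rightarrow>\<^bsub>CL\<^esub> 'b) set"
  show "f + g + h = f + (g + h)" "f + g = g + f" "0 + f = f" "- f + f = 0" "f - g = f + - g"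
    by (transfer; simp add: fun_eq_iff algebra_simps)+
  show add_right: "c *\<^sub>C (f + g) = c *\<^sub>C f + c *\<^sub>C g"
    by transfer (simp add: scaleC_add_right)
  show add_left: "(c + d) *\<^sub>C f = c *\<^sub>C f + d *\<^sub>C f" for c d
    by transfer (simp add: scaleC_add_left)
  show assoc: "c *\<^sub>C d *\<^sub>C f = (c * d) *\<^sub>C f" for c d
    by transfer (simp add: scaleC_scaleC)
  show "complex_of_real r *\<^sub>C f = r *\<^sub>R f"
    by (simp add: scaleR_cblinfun_def)
  show "r *\<^sub>R (f + g) = r *\<^sub>R f + r *\<^sub>R g"
    unfolding scaleR_cblinfun_def by transfer (simp add: scaleC_add_right)
  show "(r + s) *\<^sub>R f = r *\<^sub>R f + s *\<^sub>R f" "r *\<^sub>R s *\<^sub>R f = (r * s) *\<^sub>R f"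
    by (simp_all add: scaleR_cblinfun_def add_left assoc)
  show "1 *\<^sub>R f = f"
    unfolding scaleR_cblinfun_def by transfer simp
  show "norm (c *\<^sub>C f) = cmod c * norm f" for c
    by transfer (simp add: onorm_scaleC bounded_clinear_def)
  then show "norm (r *\<^sub>R f) = \<bar>r\<bar> * norm f"
    by (simp add: scaleR_cblinfun_def)
  show "norm (f + g) \<le> norm f + norm g"
    by transfer (simp add: onorm_triangle bounded_clinear_def)
  show "norm f = 0 \<longleftrightarrow> f = 0"
    by transfer (simp add: onorm_eq_0 bounded_clinear_def fun_eq_iff)
qed (rule dist_cblinfun_def sgn_cblinfun_def uniformity_cblinfun_def open_cblinfun_def)+

end

lemma norm_cblinfun: "norm (f *\<^sub>V x) \<le> norm f * norm x"
  by transfer (simp add: bounded_clinear_def onorm)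

type_synonym 'a dual = "'a \<Rightarrow>\<^bsub>CL\<^esub> complex"

text \<open>Composition, adjoint $T^*$ and the canonical embedding of a space into its bidual.\<close>

lift_definition cblinfun_compose ::
  "('b::complex_normed_vector \<Rightarrow>\<^bsub>CL\<^esub> 'c::complex_normed_vector) \<Rightarrow>
   ('a::complex_normed_vector \<Rightarrow>\<^bsub>CL\<^esub> 'b) \<Rightarrow> 'a \<Rightarrow>\<^bsub>CL\<^esub> 'c"  (infixl \<open>o\<^sub>C\<close> 55)
  is "\<lambda>S T x. S (T x)"
  by (simp add: bounded_clinear_def bounded_linear_compose)

lemma cblinfun_compose_apply [simp]: "(S o\<^sub>C T) *\<^sub>V x = S *\<^sub>V (T *\<^sub>V x)"
  by transfer simp

lemma norm_cblinfun_compose: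
  fixes S :: "'b::complex_normed_vector \<Rightarrow>\<^bsub>CL\<^esub> 'c::complex_normed_vector"
    and T :: "'a::complex_normed_vector \<Rightarrow>\<^bsub>CL\<^esub> 'b"
  shows "norm (S o\<^sub>C T) \<le> norm S * norm T"
proof transfer
  fix S :: "'b \<Rightarrow> 'c" and T :: "'a \<Rightarrow> 'b"
  assume "bounded_clinear S" "bounded_clinear T"
  then show "onorm (\<lambda>x. S (T x)) \<le> onorm S * onorm T"
    using onorm_compose[of S T] by (simp add: bounded_clinear_def comp_def)
qed

lemma norm_cblinfun_bound:
  "0 \<le> K \<Longrightarrow> (\<And>x. norm (f *\<^sub>V x) \<le> K * norm x) \<Longrightarrow> norm f \<le> K"
  by transfer (rule onorm_bound)

lift_definition adjoint ::
  "('a::complex_normed_vector \<Rightarrow>\<^bsub>CL\<^esub> 'b::complex_normed_vector) \<Rightarrow> 'b dual \<Rightarrow>\<^bsub>CL\<^esub> 'a dual"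
  is "\<lambda>T f. f o\<^sub>C T"
proof -
  fix T :: "'a \<Rightarrow>\<^bsub>CL\<^esub> 'b"
  have "bounded_linear (\<lambda>f :: 'b dual. f o\<^sub>C T)"
  proof (rule bounded_linear_intro[where K = "norm T"])
    fix f g :: "'b dual" and r :: real
    show "(f + g) o\<^sub>C T = (f o\<^sub>C T) + (g o\<^sub>C T)"
      by transfer simp
    show "(r *\<^sub>R f) o\<^sub>C T = r *\<^sub>R (f o\<^sub>C T)"
      unfolding scaleR_cblinfun_def by transfer simp
    show "norm (f o\<^sub>C T) \<le> norm f * norm T"
      by (rule norm_cblinfun_compose)
  qed
  moreover have "(c *\<^sub>C f) o\<^sub>C T = c *\<^sub>C (f o\<^sub>C T)" for c and f :: "'b dual"
    by transfer simp
  ultimately show "bounded_clinear (\<lambda>f :: 'b dual. f o\<^sub>C T)"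
    by (simp add: bounded_clinear_def)
qed

lift_definition bidual_embedding :: "'a::complex_normed_vector \<Rightarrow> 'a dual dual"
  is "\<lambda>x f. f *\<^sub>V x"
proof -
  fix x :: 'a
  have "bounded_linear (\<lambda>f :: 'a dual. f *\<^sub>V x)"
  proof (rule bounded_linear_intro[where K = "norm x"])
    fix f g :: "'a dual" and r :: real
    show "(f + g) *\<^sub>V x = f *\<^sub>V x + g *\<^sub>V x"
      by transfer simp
    show "(r *\<^sub>R f) *\<^sub>V x = r *\<^sub>R (f *\<^sub>V x)"
      unfolding scaleR_cblinfun_def by transfer (simp add: scaleC_of_real)
    show "norm (f *\<^sub>V x) \<le> norm f * norm x"
      by (rule norm_cblinfun)
  qed
  moreover have "(c *\<^sub>C f) *\<^sub>V x = c *\<^sub>C (f *\<^sub>V x)" for c and f :: "'a dual"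
    by transfer simp
  ultimately show "bounded_clinear (\<lambda>f :: 'a dual. f *\<^sub>V x)"
    by (simp add: bounded_clinear_def)
qed


lemma adjoint_apply: "(adjoint T *\<^sub>V f) *\<^sub>V x = f *\<^sub>V (T *\<^sub>V x)"
  by (simp add: adjoint.rep_eq)

lemma bidual_embedding_apply: "bidual_embedding x *\<^sub>V f = f *\<^sub>V x"
  by (simp add: bidual_embedding.rep_eq)


section \<open>The algebraic tensor product\<close>

text \<open>The free complex vector space on \<open>'a \<times> 'b\<close> modulo the bilinearity relations.\<close>

definition free_scale :: "complex \<Rightarrow> ('i \<Rightarrow>\<^sub>0 complex) \<Rightarrow> ('i \<Rightarrow>\<^sub>0 complex)"
  where "free_scale c = Poly_Mapping.map ((*) c)"

lemma lookup_free_scale [simp]: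
  "Poly_Mapping.lookup (free_scale c u) i = c * Poly_Mapping.lookup u i"
  unfolding free_scale_def by transfer (simp add: when_def)

interpretation free: vector_space "free_scale :: complex \<Rightarrow> ('i \<Rightarrow>\<^sub>0 complex) \<Rightarrow> _"
  by standard (auto intro!: poly_mapping_eqI simp: lookup_add algebra_simps)

definition gen :: "'a \<Rightarrow> 'b \<Rightarrow> ('a \<times> 'b) \<Rightarrow>\<^sub>0 complex"
  where "gen a b = Poly_Mapping.single (a, b) 1"

definition bilinearity_relations ::
    "(('a::complex_vector \<times> 'b::complex_vector) \<Rightarrow>\<^sub>0 complex) set"
  where "bilinearity_relations =
    {gen (a + a') b - (gen a b + gen a' b) | a a' b. True} \<union>
    {gen a (b + b') - (gen a b + gen a b') | a b b'. True} \<union>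
    {gen (c *\<^sub>C a) b - free_scale c (gen a b) | c a b. True} \<union>
    {gen a (c *\<^sub>C b) - free_scale c (gen a b) | c a b. True}"

definition tensor_eq ::
    "(('a::complex_vector \<times> 'b::complex_vector) \<Rightarrow>\<^sub>0 complex) \<Rightarrow> (('a \<times> 'b) \<Rightarrow>\<^sub>0 complex) \<Rightarrow> bool"
  where "tensor_eq u v \<longleftrightarrow> u - v \<in> free.span bilinearity_relations"

lemma equivp_tensor_eq:
  "equivp (tensor_eq :: (('a::complex_vector \<times> 'b::complex_vector) \<Rightarrow>\<^sub>0 complex) \<Rightarrow> _)"
  (is "equivp ?R")
proof (rule equivpI)
  show "reflp ?R"
    by (simp add: reflp_def tensor_eq_def free.span_zero)
  show "symp ?R"
    unfolding symp_def tensor_eq_def using free.span_neg by fastforce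
  show "transp ?R"
  proof (rule transpI)
    fix x y z :: "('a \<times> 'b) \<Rightarrow>\<^sub>0 complex"
    assume "tensor_eq x y" "tensor_eq y z"
    then have "(x - y) + (y - z) \<in> free.span bilinearity_relations"
      unfolding tensor_eq_def by (rule free.span_add)
    then show "tensor_eq x z" by (simp add: tensor_eq_def)
  qed
qed

quotient_type (overloaded) ('a, 'b) tensor =
  "('a::complex_vector \<times> 'b::complex_vector) \<Rightarrow>\<^sub>0 complex" / tensor_eq
  by (rule equivp_tensor_eq)

instantiation tensor :: (complex_vector, complex_vector) complex_vector
begin

lift_definition zero_tensor :: "('a, 'b) tensor" is 0 .

lift_definition plus_tensor :: "('a, 'b) tensor \<Rightarrow> ('a, 'b) tensor \<Rightarrow> ('a, 'b) tensor" is "(+)"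
proof -
  fix u u' v v' :: "('a \<times> 'b) \<Rightarrow>\<^sub>0 complex"
  assume "tensor_eq u u'" "tensor_eq v v'"
  then have "(u - u') + (v - v') \<in> free.span bilinearity_relations"
    unfolding tensor_eq_def by (rule free.span_add)
  then show "tensor_eq (u + v) (u' + v')" by (simp add: tensor_eq_def algebra_simps)
qed

lift_definition minus_tensor :: "('a, 'b) tensor \<Rightarrow> ('a, 'b) tensor \<Rightarrow> ('a, 'b) tensor" is "(-)"
proof -
  fix u u' v v' :: "('a \<times> 'b) \<Rightarrow>\<^sub>0 complex"
  assume "tensor_eq u u'" "tensor_eq v v'"
  then have "(u - u') - (v - v') \<in> free.span bilinearity_relations"
    unfolding tensor_eq_def by (rule free.span_diff)
  then show "tensor_eq (u - v) (u' - v')" by (simp add: tensor_eq_def algebra_simps)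
qed

lift_definition uminus_tensor :: "('a, 'b) tensor \<Rightarrow> ('a, 'b) tensor" is "uminus"
proof -
  fix u u' :: "('a \<times> 'b) \<Rightarrow>\<^sub>0 complex"
  assume "tensor_eq u u'"
  then have "- (u - u') \<in> free.span bilinearity_relations"
    unfolding tensor_eq_def by (rule free.span_neg)
  then show "tensor_eq (- u) (- u')" by (simp add: tensor_eq_def algebra_simps)
qed

lift_definition scaleC_tensor :: "complex \<Rightarrow> ('a, 'b) tensor \<Rightarrow> ('a, 'b) tensor" is free_scale
proof -
  fix c and u u' :: "('a \<times> 'b) \<Rightarrow>\<^sub>0 complex"
  assume "tensor_eq u u'"
  then have "free_scale c (u - u') \<in> free.span bilinearity_relations"
    unfolding tensor_eq_def by (rule free.span_scale)
  then show "tensor_eq (free_scale c u) (free_scale c u')"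
    by (simp add: tensor_eq_def free.scale_right_diff_distrib)
qed

definition scaleR_tensor :: "real \<Rightarrow> ('a, 'b) tensor \<Rightarrow> ('a, 'b) tensor"
  where "scaleR_tensor r u = complex_of_real r *\<^sub>C u"

instance
proof
  fix u v w :: "('a, 'b) tensor" and c d :: complex and r s :: real
  have refl: "tensor_eq z z" for z :: "('a \<times> 'b) \<Rightarrow>\<^sub>0 complex"
    using equivp_tensor_eq by (rule equivp_reflp)
  show "u + v + w = u + (v + w)" "u + v = v + u" "0 + u = u" "- u + u = 0" "u - v = u + - v"
    by (transfer; simp add: refl algebra_simps)+
  show add_right: "c *\<^sub>C (u + v) = c *\<^sub>C u + c *\<^sub>C v" for c
    by transfer (simp add: refl free.scale_right_distrib)
  show add_left: "(c + d) *\<^sub>C u = c *\<^sub>C u + d *\<^sub>C u" for c d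
    by transfer (simp add: refl free.scale_left_distrib)
  show assoc: "c *\<^sub>C d *\<^sub>C u = (c * d) *\<^sub>C u" for c d
    by transfer (simp add: refl)
  have one: "1 *\<^sub>C u = u"
    by transfer (simp add: refl)
  show "complex_of_real r *\<^sub>C u = r *\<^sub>R u"
    by (simp add: scaleR_tensor_def)
  show "r *\<^sub>R (u + v) = r *\<^sub>R u + r *\<^sub>R v" "(r + s) *\<^sub>R u = r *\<^sub>R u + s *\<^sub>R u"
    "r *\<^sub>R s *\<^sub>R u = (r * s) *\<^sub>R u" "1 *\<^sub>R u = u"
    by (simp_all add: scaleR_tensor_def add_right add_left assoc one)
qed

end

lift_definition elem_tensor :: "'a::complex_vector \<Rightarrow> 'b::complex_vector \<Rightarrow> ('a, 'b) tensor"
  is gen .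

lemma elem_tensor_add_left: "elem_tensor (a + a') b = elem_tensor a b + elem_tensor a' b"
  by transfer (unfold tensor_eq_def bilinearity_relations_def, rule free.span_base, blast)

lemma elem_tensor_add_right: "elem_tensor a (b + b') = elem_tensor a b + elem_tensor a b'"
  by transfer (unfold tensor_eq_def bilinearity_relations_def, rule free.span_base, blast)

lemma elem_tensor_scaleC_left: "elem_tensor (c *\<^sub>C a) b = c *\<^sub>C elem_tensor a b"
  by transfer (unfold tensor_eq_def bilinearity_relations_def, rule free.span_base, blast)

lemma elem_tensor_scaleC_right: "elem_tensor a (c *\<^sub>C b) = c *\<^sub>C elem_tensor a b"
  by transfer (unfold tensor_eq_def bilinearity_relations_def, rule free.span_base, blast)

definition list_tensor :: "('a::complex_vector \<times> 'b::complex_vector) list \<Rightarrow> ('a, 'b) tensor"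
  where "list_tensor ps = (\<Sum>(a, b)\<leftarrow>ps. elem_tensor a b)"

lemma free_induct:
  fixes u :: "'i \<Rightarrow>\<^sub>0 complex"
  assumes "P 0" "\<And>i c u. P u \<Longrightarrow> P (Poly_Mapping.single i c + u)"
  shows "P u"
proof -
  have "P v" if "finite K" "Poly_Mapping.keys v \<subseteq> K" for K and v :: "'i \<Rightarrow>\<^sub>0 complex"
    using that
  proof (induction K arbitrary: v rule: finite_induct)
    case empty
    then show ?case using assms(1) by simp
  next
    case (insert k K)
    let ?w = "v - Poly_Mapping.single k (Poly_Mapping.lookup v k)"
    have "Poly_Mapping.keys ?w \<subseteq> K"
      using insert.prems
      by (auto simp: in_keys_iff lookup_minus lookup_single when_def split: if_splits)
    then have "P ?w" by (rule insert.IH)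
    then have "P (Poly_Mapping.single k (Poly_Mapping.lookup v k) + ?w)" by (rule assms(2))
    then show ?case by simp
  qed
  from this[OF finite_keys subset_refl] show ?thesis .
qed

lemma ex_list_tensor: "\<exists>ps. u = list_tensor ps"
proof -
  have "\<exists>ps. abs_tensor z = list_tensor ps" for z :: "('a \<times> 'b) \<Rightarrow>\<^sub>0 complex"
  proof (induction z rule: free_induct)
    case 1
    have "abs_tensor 0 = (0 :: ('a, 'b) tensor)" by (simp add: zero_tensor_def)
    then have "abs_tensor 0 = (list_tensor [] :: ('a, 'b) tensor)"
      by (simp add: list_tensor_def)
    then show ?case by blast
  next
    case (2 i c z)
    then obtain ps where ps: "abs_tensor z = list_tensor ps" by blast
    obtain a b where i: "i = (a, b)" by (cases i)
    have "Poly_Mapping.single i c = free_scale c (gen a b)"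
      by (simp add: free_scale_def gen_def i)
    then have "abs_tensor (Poly_Mapping.single i c + z) = c *\<^sub>C elem_tensor a b + abs_tensor z"
      by (simp add: plus_tensor.abs_eq elem_tensor.abs_eq scaleC_tensor.abs_eq)
    also have "\<dots> = list_tensor ((c *\<^sub>C a, b) # ps)"
      by (simp add: ps list_tensor_def elem_tensor_scaleC_left)
    finally show ?case by blast
  qed
  moreover have "u = abs_tensor (rep_tensor u)"
    by (rule Quotient3_abs_rep[OF Quotient3_tensor, symmetric])
  ultimately show ?thesis by metis
qed


section \<open>The projective norm\<close>

definition list_cost :: "('a::real_normed_vector \<times> 'b::real_normed_vector) list \<Rightarrow> real"
  where "list_cost ps = (\<Sum>(a, b)\<leftarrow>ps. norm a * norm b)"

text \<open>The projective norm, the infimum of \<open>\<Sum>\<parallel>a\<^sub>i\<parallel>\<parallel>b\<^sub>i\<parallel>\<close> over all representations as finite sums of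
  elementary tensors. Only its seminorm properties are proved; the completion below is insensitive
  to whether it is definite.\<close>

definition proj_norm :: "('a::complex_normed_vector, 'b::complex_normed_vector) tensor \<Rightarrow> real"
  where "proj_norm u = Inf {list_cost ps | ps. u = list_tensor ps}"

lemma list_cost_nonneg: "0 \<le> list_cost ps"
  unfolding list_cost_def by (rule sum_list_nonneg) auto

lemma proj_norm_le: "proj_norm (list_tensor ps) \<le> list_cost ps"
  unfolding proj_norm_def
  by (rule cInf_lower) (auto intro!: bdd_belowI[of _ 0] list_cost_nonneg)

lemma proj_norm_nonneg: "0 \<le> proj_norm u"
  unfolding proj_norm_def using ex_list_tensor[of u]
  by (intro cInf_greatest) (auto simp: list_cost_nonneg)

lemma proj_norm_approx:
  assumes "proj_norm u < r"
  obtains ps where "u = list_tensor ps" "list_cost ps < r"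
proof -
  have "{list_cost ps | ps. u = list_tensor ps} \<noteq> {}"
    using ex_list_tensor[of u] by auto
  from cInf_lessD[OF this assms[unfolded proj_norm_def]] show ?thesis
    using that by auto
qed

lemma proj_norm_elem: "proj_norm (elem_tensor a b) \<le> norm a * norm b"
  using proj_norm_le[of "[(a, b)]"] by (simp add: list_tensor_def list_cost_def)

lemma proj_norm_zero [simp]:
  "proj_norm (0 :: ('a::complex_normed_vector, 'b::complex_normed_vector) tensor) = 0"
  using proj_norm_le[of "[] :: ('a \<times> 'b) list"] proj_norm_nonneg[of "0 :: ('a, 'b) tensor"]
  by (simp add: list_tensor_def list_cost_def)

lemma proj_norm_triangle: "proj_norm (u + v) \<le> proj_norm u + proj_norm v"
proof (rule field_le_epsilon)
  fix e :: real assume "0 < e"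
  then obtain ps qs where ps: "u = list_tensor ps" "list_cost ps < proj_norm u + e / 2"
    and qs: "v = list_tensor qs" "list_cost qs < proj_norm v + e / 2"
    by (metis less_add_same_cancel1 half_gt_zero proj_norm_approx)
  have "proj_norm (u + v) \<le> list_cost (ps @ qs)"
    using proj_norm_le[of "ps @ qs"] by (simp add: ps(1) qs(1) list_tensor_def)
  also have "\<dots> = list_cost ps + list_cost qs" by (simp add: list_cost_def)
  finally show "proj_norm (u + v) \<le> proj_norm u + proj_norm v + e"
    using ps(2) qs(2) by simp
qed

lemma proj_norm_scaleC_le:
  fixes u :: "('a::complex_normed_vector, 'b::complex_normed_vector) tensor"
  shows "proj_norm (c *\<^sub>C u) \<le> cmod c * proj_norm u"
proof (cases "c = 0")
  case False
  show ?thesis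
  proof (rule field_le_epsilon)
    fix e :: real assume "0 < e"
    with False have "proj_norm u < proj_norm u + e / cmod c" by simp
    then obtain ps where ps: "u = list_tensor ps" "list_cost ps < proj_norm u + e / cmod c"
      by (rule proj_norm_approx)
    let ?f = "map (\<lambda>(a, b). (c *\<^sub>C a, b)) :: ('a \<times> 'b) list \<Rightarrow> _"
    let ?qs = "?f ps"
    have "list_tensor (?f ps) = c *\<^sub>C list_tensor ps" for ps
      by (induction ps) (auto simp: list_tensor_def elem_tensor_scaleC_left scaleC_add_right)
    moreover have "list_cost (?f ps) = cmod c * list_cost ps" for ps
      by (induction ps) (auto simp: list_cost_def norm_scaleC algebra_simps)
    ultimately have "proj_norm (c *\<^sub>C u) \<le> cmod c * list_cost ps"
      using proj_norm_le[of ?qs] by (simp add: ps(1))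
    also have "\<dots> \<le> cmod c * (proj_norm u + e / cmod c)"
      using ps(2) by (intro mult_left_mono) auto
    also have "\<dots> = cmod c * proj_norm u + e"
      using False by (simp add: algebra_simps)
    finally show "proj_norm (c *\<^sub>C u) \<le> cmod c * proj_norm u + e" .
  qed
qed simp

lemma proj_norm_scaleC: "proj_norm (c *\<^sub>C u) = cmod c * proj_norm u"
proof (cases "c = 0")
  case False
  have "proj_norm u = proj_norm (inverse c *\<^sub>C c *\<^sub>C u)"
    using False by (simp add: scaleC_scaleC)
  also have "\<dots> \<le> cmod (inverse c) * proj_norm (c *\<^sub>C u)" by (rule proj_norm_scaleC_le)
  finally have "cmod c * proj_norm u \<le> cmod c * (cmod (inverse c) * proj_norm (c *\<^sub>C u))"
    by (rule mult_left_mono) simp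
  also have "\<dots> = proj_norm (c *\<^sub>C u)"
    using False by (simp add: norm_inverse)
  finally have "cmod c * proj_norm u \<le> proj_norm (c *\<^sub>C u)" .
  then show ?thesis using proj_norm_scaleC_le[of c u] by simp
qed simp

lemma proj_norm_minus [simp]: "proj_norm (- u) = proj_norm u"
  using proj_norm_scaleC[of "-1" u] by simp

lemma proj_norm_minus_commute: "proj_norm (u - v) = proj_norm (v - u)"
  using proj_norm_minus[of "u - v"] by simp

lemma proj_norm_diff_le: "\<bar>proj_norm u - proj_norm v\<bar> \<le> proj_norm (u - v)"
  using proj_norm_triangle[of "u - v" v] proj_norm_triangle[of "v - u" u]
  by (simp add: proj_norm_minus_commute[of v u])


section \<open>The projective tensor product\<close>

text \<open>The completion of the algebraic tensor product in the projective norm, as the space of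
  Cauchy sequences modulo null sequences.\<close>

definition proj_Cauchy ::
    "(nat \<Rightarrow> ('a::complex_normed_vector, 'b::complex_normed_vector) tensor) \<Rightarrow> bool"
  where "proj_Cauchy X \<longleftrightarrow> (\<forall>e>0. \<exists>N. \<forall>m\<ge>N. \<forall>n\<ge>N. proj_norm (X m - X n) < e)"

definition ptensor_eq ::
    "(nat \<Rightarrow> ('a::complex_normed_vector, 'b::complex_normed_vector) tensor) \<Rightarrow>
     (nat \<Rightarrow> ('a, 'b) tensor) \<Rightarrow> bool"
  where "ptensor_eq X Y \<longleftrightarrow>
    proj_Cauchy X \<and> proj_Cauchy Y \<and> (\<lambda>n. proj_norm (X n - Y n)) \<longlonglongrightarrow> 0"

lemma proj_Cauchy_const [simp]: "proj_Cauchy (\<lambda>_. u)"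
  by (simp add: proj_Cauchy_def)

lemma proj_Cauchy_add:
  assumes "proj_Cauchy X" "proj_Cauchy Y"
  shows "proj_Cauchy (\<lambda>n. X n + Y n)"
  unfolding proj_Cauchy_def
proof (intro allI impI)
  fix e :: real assume "0 < e"
  then have "0 < e / 2" by simp
  then obtain M N where M: "\<forall>m\<ge>M. \<forall>n\<ge>M. proj_norm (X m - X n) < e / 2"
    and N: "\<forall>m\<ge>N. \<forall>n\<ge>N. proj_norm (Y m - Y n) < e / 2"
    using assms unfolding proj_Cauchy_def by meson
  have "proj_norm (X m + Y m - (X n + Y n)) < e" if "m \<ge> max M N" "n \<ge> max M N" for m n
  proof -
    have "proj_norm (X m + Y m - (X n + Y n)) \<le> proj_norm (X m - X n) + proj_norm (Y m - Y n)"
      using proj_norm_triangle[of "X m - X n" "Y m - Y n"] by (simp add: algebra_simps)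
    moreover have "proj_norm (X m - X n) < e / 2" "proj_norm (Y m - Y n) < e / 2"
      using M N that by auto
    ultimately show ?thesis by linarith
  qed
  then show "\<exists>N. \<forall>m\<ge>N. \<forall>n\<ge>N. proj_norm (X m + Y m - (X n + Y n)) < e" by blast
qed

lemma proj_Cauchy_scaleC:
  assumes "proj_Cauchy X"
  shows "proj_Cauchy (\<lambda>n. c *\<^sub>C X n)"
proof (cases "c = 0")
  case False
  show ?thesis
    unfolding proj_Cauchy_def
  proof (intro allI impI)
    fix e :: real assume "0 < e"
    with False have "0 < e / cmod c" by simp
    then obtain N where "\<forall>m\<ge>N. \<forall>n\<ge>N. proj_norm (X m - X n) < e / cmod c"
      using assms unfolding proj_Cauchy_def by meson
    then have "\<forall>m\<ge>N. \<forall>n\<ge>N. cmod c * proj_norm (X m - X n) < e"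
      using False by (simp add: pos_less_divide_eq mult.commute)
    then have "\<forall>m\<ge>N. \<forall>n\<ge>N. proj_norm (c *\<^sub>C X m - c *\<^sub>C X n) < e"
      by (metis complex_vector.scale_right_diff_distrib proj_norm_scaleC)
    then show "\<exists>N. \<forall>m\<ge>N. \<forall>n\<ge>N. proj_norm (c *\<^sub>C X m - c *\<^sub>C X n) < e" by blast
  qed
qed simp

lemma proj_Cauchy_norm:
  assumes "proj_Cauchy X"
  shows "(\<lambda>n. proj_norm (X n)) \<longlonglongrightarrow> lim (\<lambda>n. proj_norm (X n))"
proof -
  have "Cauchy (\<lambda>n. proj_norm (X n))"
    using assms unfolding Cauchy_def dist_real_def proj_Cauchy_def
    by (meson le_less_trans proj_norm_diff_le)
  then show ?thesis by (simp add: Cauchy_convergent_iff convergent_LIMSEQ_iff)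
qed

lemma ptensor_eq_refl: "proj_Cauchy X \<Longrightarrow> ptensor_eq X X"
  by (simp add: ptensor_eq_def)

lemma ptensor_eq_add:
  assumes "ptensor_eq X X'" "ptensor_eq Y Y'"
  shows "ptensor_eq (\<lambda>n. X n + Y n) (\<lambda>n. X' n + Y' n)"
proof -
  have "(\<lambda>n. proj_norm (X n - X' n) + proj_norm (Y n - Y' n)) \<longlonglongrightarrow> 0 + 0"
    using assms unfolding ptensor_eq_def by (intro tendsto_add) auto
  then have "(\<lambda>n. proj_norm (X n - X' n) + proj_norm (Y n - Y' n)) \<longlonglongrightarrow> 0" by simp
  then have "(\<lambda>n. proj_norm (X n + Y n - (X' n + Y' n))) \<longlonglongrightarrow> 0"
  proof (rule Lim_null_comparison[rotated], intro always_eventually allI)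
    fix n
    show "norm (proj_norm (X n + Y n - (X' n + Y' n))) \<le> proj_norm (X n - X' n) + proj_norm (Y n - Y' n)"
      using proj_norm_triangle[of "X n - X' n" "Y n - Y' n"]
      by (simp add: algebra_simps proj_norm_nonneg)
  qed
  then show ?thesis using assms by (simp add: ptensor_eq_def proj_Cauchy_add)
qed

lemma ptensor_eq_scaleC:
  assumes "ptensor_eq X X'"
  shows "ptensor_eq (\<lambda>n. c *\<^sub>C X n) (\<lambda>n. c *\<^sub>C X' n)"
proof -
  have "(\<lambda>n. cmod c * proj_norm (X n - X' n)) \<longlonglongrightarrow> cmod c * 0"
    using assms unfolding ptensor_eq_def by (intro tendsto_mult) auto
  then show ?thesis
    using assms
    by (simp add: ptensor_eq_def proj_Cauchy_scaleC proj_norm_scaleC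
        flip: complex_vector.scale_right_diff_distrib)
qed

lemma part_equivp_ptensor_eq:
  "part_equivp (ptensor_eq ::
    (nat \<Rightarrow> ('a::complex_normed_vector, 'b::complex_normed_vector) tensor) \<Rightarrow> _)"
  (is "part_equivp ?R")
proof (rule part_equivpI)
  show "\<exists>X. ?R X X"
    by (rule exI[of _ "\<lambda>_. 0"]) (simp add: ptensor_eq_refl)
  show "symp ?R"
    by (simp add: symp_def ptensor_eq_def proj_norm_minus_commute)
  show "transp ?R"
  proof (rule transpI)
    fix X Y Z :: "nat \<Rightarrow> ('a, 'b) tensor"
    assume XY: "ptensor_eq X Y" and YZ: "ptensor_eq Y Z"
    have "(\<lambda>n. proj_norm (X n - Y n) + proj_norm (Y n - Z n)) \<longlonglongrightarrow> 0 + 0"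
      using XY YZ unfolding ptensor_eq_def by (intro tendsto_add) auto
    then have "(\<lambda>n. proj_norm (X n - Y n) + proj_norm (Y n - Z n)) \<longlonglongrightarrow> 0" by simp
    then have "(\<lambda>n. proj_norm (X n - Z n)) \<longlonglongrightarrow> 0"
    proof (rule Lim_null_comparison[rotated], intro always_eventually allI)
      fix n
      show "norm (proj_norm (X n - Z n)) \<le> proj_norm (X n - Y n) + proj_norm (Y n - Z n)"
        using proj_norm_triangle[of "X n - Y n" "Y n - Z n"] by (simp add: proj_norm_nonneg)
    qed
    with XY YZ show "ptensor_eq X Z" by (simp add: ptensor_eq_def)
  qed
qed

quotient_type (overloaded) ('a, 'b) ptensor =
  "nat \<Rightarrow> ('a::complex_normed_vector, 'b::complex_normed_vector) tensor" / partial: ptensor_eq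
  by (rule part_equivp_ptensor_eq)

instantiation ptensor :: (complex_normed_vector, complex_normed_vector) complex_normed_vector
begin

lift_definition zero_ptensor :: "('a, 'b) ptensor" is "\<lambda>_. 0"
  by (simp add: ptensor_eq_refl)

lift_definition plus_ptensor :: "('a, 'b) ptensor \<Rightarrow> ('a, 'b) ptensor \<Rightarrow> ('a, 'b) ptensor"
  is "\<lambda>X Y n. X n + Y n"
  by (rule ptensor_eq_add)

lift_definition scaleC_ptensor :: "complex \<Rightarrow> ('a, 'b) ptensor \<Rightarrow> ('a, 'b) ptensor"
  is "\<lambda>c X n. c *\<^sub>C X n"
  by (rule ptensor_eq_scaleC)

lift_definition norm_ptensor :: "('a, 'b) ptensor \<Rightarrow> real" is "\<lambda>X. lim (\<lambda>n. proj_norm (X n))"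
proof -
  fix X Y :: "nat \<Rightarrow> ('a, 'b) tensor"
  assume XY: "ptensor_eq X Y"
  then have "(\<lambda>n. proj_norm (X n) - proj_norm (Y n)) \<longlonglongrightarrow> 0"
    unfolding ptensor_eq_def
    by (auto intro!: Lim_null_comparison[of _ "\<lambda>n. proj_norm (X n - Y n)"]
        always_eventually proj_norm_diff_le)
  moreover have "(\<lambda>n. proj_norm (X n) - proj_norm (Y n)) \<longlonglongrightarrow>
      lim (\<lambda>n. proj_norm (X n)) - lim (\<lambda>n. proj_norm (Y n))"
    using XY unfolding ptensor_eq_def by (intro tendsto_diff proj_Cauchy_norm) auto
  ultimately show "lim (\<lambda>n. proj_norm (X n)) = lim (\<lambda>n. proj_norm (Y n))"
    using LIMSEQ_unique by fastforce
qed

definition uminus_ptensor :: "('a, 'b) ptensor \<Rightarrow> ('a, 'b) ptensor"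
  where "uminus_ptensor x = (-1) *\<^sub>C x"

definition minus_ptensor :: "('a, 'b) ptensor \<Rightarrow> ('a, 'b) ptensor \<Rightarrow> ('a, 'b) ptensor"
  where "minus_ptensor x y = x + (- y)"

definition scaleR_ptensor :: "real \<Rightarrow> ('a, 'b) ptensor \<Rightarrow> ('a, 'b) ptensor"
  where "scaleR_ptensor r x = complex_of_real r *\<^sub>C x"

definition dist_ptensor :: "('a, 'b) ptensor \<Rightarrow> ('a, 'b) ptensor \<Rightarrow> real"
  where "dist_ptensor x y = norm (x - y)"

definition sgn_ptensor :: "('a, 'b) ptensor \<Rightarrow> ('a, 'b) ptensor"
  where "sgn_ptensor x = inverse (norm x) *\<^sub>R x"

definition uniformity_ptensor :: "(('a, 'b) ptensor \<times> ('a, 'b) ptensor) filter"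
  where "uniformity_ptensor = (INF e\<in>{0<..}. principal {(x, y). dist x y < e})"

definition open_ptensor :: "('a, 'b) ptensor set \<Rightarrow> bool"
  where "open_ptensor S = (\<forall>x\<in>S. \<forall>\<^sub>F (x', y) in uniformity. x' = x \<longrightarrow> y \<in> S)"

instance
proof
  fix x y z :: "('a, 'b) ptensor" and c d :: complex and r s :: real
  have eqI: "ptensor_eq X Y" if "proj_Cauchy X" "X = Y" for X Y :: "nat \<Rightarrow> ('a, 'b) tensor"
    using that by (simp add: ptensor_eq_refl)
  have C: "proj_Cauchy X" if "ptensor_eq X X" for X :: "nat \<Rightarrow> ('a, 'b) tensor"
    using that by (simp add: ptensor_eq_def)
  show "x + y + z = x + (y + z)" "x + y = y + x" "0 + x = x"
    by (transfer; auto dest!: C intro!: eqI proj_Cauchy_add simp: algebra_simps)+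
  show "- x + x = 0"
    unfolding uminus_ptensor_def
    by transfer (auto dest!: C intro!: eqI proj_Cauchy_add proj_Cauchy_scaleC)
  show "x - y = x + - y"
    by (rule minus_ptensor_def)
  show add_right: "c *\<^sub>C (x + y) = c *\<^sub>C x + c *\<^sub>C y" for c
    by transfer
      (auto dest!: C intro!: eqI proj_Cauchy_add proj_Cauchy_scaleC simp: scaleC_add_right)
  show add_left: "(c + d) *\<^sub>C x = c *\<^sub>C x + d *\<^sub>C x" for c d
    by transfer
      (auto dest!: C intro!: eqI proj_Cauchy_add proj_Cauchy_scaleC simp: scaleC_add_left)
  show assoc: "c *\<^sub>C d *\<^sub>C x = (c * d) *\<^sub>C x" for c d
    by transfer
      (auto dest!: C intro!: eqI proj_Cauchy_add proj_Cauchy_scaleC simp: scaleC_scaleC)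
  have one: "1 *\<^sub>C x = x"
    by transfer simp
  show "complex_of_real r *\<^sub>C x = r *\<^sub>R x"
    by (simp add: scaleR_ptensor_def)
  show "r *\<^sub>R (x + y) = r *\<^sub>R x + r *\<^sub>R y" "(r + s) *\<^sub>R x = r *\<^sub>R x + s *\<^sub>R x"
    "r *\<^sub>R s *\<^sub>R x = (r * s) *\<^sub>R x" "1 *\<^sub>R x = x"
    by (simp_all add: scaleR_ptensor_def add_right add_left assoc one)
  show norm_scaleC: "norm (c *\<^sub>C x) = cmod c * norm x" for c
  proof transfer
    fix c and X :: "nat \<Rightarrow> ('a, 'b) tensor"
    assume "ptensor_eq X X"
    then have "(\<lambda>n. cmod c * proj_norm (X n)) \<longlonglongrightarrow> cmod c * lim (\<lambda>n. proj_norm (X n))"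
      by (intro tendsto_mult tendsto_const proj_Cauchy_norm C)
    then show "lim (\<lambda>n. proj_norm (c *\<^sub>C X n)) = cmod c * lim (\<lambda>n. proj_norm (X n))"
      by (simp add: proj_norm_scaleC limI)
  qed
  then show "norm (r *\<^sub>R x) = \<bar>r\<bar> * norm x"
    by (simp add: scaleR_ptensor_def)
  show "norm (x + y) \<le> norm x + norm y"
  proof transfer
    fix X Y :: "nat \<Rightarrow> ('a, 'b) tensor"
    assume X: "ptensor_eq X X" and Y: "ptensor_eq Y Y"
    show "lim (\<lambda>n. proj_norm (X n + Y n)) \<le> lim (\<lambda>n. proj_norm (X n)) + lim (\<lambda>n. proj_norm (Y n))"
      by (rule LIMSEQ_le[OF proj_Cauchy_norm[OF proj_Cauchy_add[OF C[OF X] C[OF Y]]]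
            tendsto_add[OF proj_Cauchy_norm[OF C[OF X]] proj_Cauchy_norm[OF C[OF Y]]]])
        (auto intro: proj_norm_triangle)
  qed
  show "norm x = 0 \<longleftrightarrow> x = 0"
  proof transfer
    fix X :: "nat \<Rightarrow> ('a, 'b) tensor"
    assume X: "ptensor_eq X X"
    have "lim (\<lambda>n. proj_norm (X n)) = 0 \<longleftrightarrow> (\<lambda>n. proj_norm (X n)) \<longlonglongrightarrow> 0"
      using proj_Cauchy_norm[OF C[OF X]] by (metis limI)
    with C[OF X] show "lim (\<lambda>n. proj_norm (X n)) = 0 \<longleftrightarrow> ptensor_eq X (\<lambda>_. 0)"
      by (simp add: ptensor_eq_def)
  qed
qed (rule dist_ptensor_def sgn_ptensor_def uniformity_ptensor_def open_ptensor_def)+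

end

definition of_tensor ::
    "('a::complex_normed_vector, 'b::complex_normed_vector) tensor \<Rightarrow> ('a, 'b) ptensor"
  where "of_tensor u = abs_ptensor (\<lambda>_. u)"

lemma norm_of_tensor: "norm (of_tensor u) = proj_norm u"
  by (simp add: of_tensor_def norm_ptensor.abs_eq ptensor_eq_refl limI)

lemma of_tensor_add: "of_tensor (u + v) = of_tensor u + of_tensor v"
  by (simp add: of_tensor_def plus_ptensor.abs_eq ptensor_eq_refl)

lemma of_tensor_scaleC: "of_tensor (c *\<^sub>C u) = c *\<^sub>C of_tensor u"
  by (simp add: of_tensor_def scaleC_ptensor.abs_eq ptensor_eq_refl)

lemma of_tensor_zero [simp]: "of_tensor 0 = 0"
  by (simp add: of_tensor_def zero_ptensor_def)

lemma of_tensor_diff: "of_tensor (u - v) = of_tensor u - of_tensor v"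
  by (metis add_diff_cancel diff_add_cancel of_tensor_add)

lemma of_tensor_LIMSEQ:
  assumes "proj_Cauchy X"
  shows "(\<lambda>n. of_tensor (X n)) \<longlonglongrightarrow> abs_ptensor X"
proof (rule LIMSEQ_I)
  fix e :: real assume "0 < e"
  then have "0 < e / 2" by simp
  then obtain N where N: "\<forall>m\<ge>N. \<forall>n\<ge>N. proj_norm (X m - X n) < e / 2"
    using assms unfolding proj_Cauchy_def by meson
  have "norm (of_tensor (X n) - abs_ptensor X) < e" if "n \<ge> N" for n
  proof -
    let ?Y = "\<lambda>k. X n + (-1) *\<^sub>C X k"
    have Y: "proj_Cauchy ?Y"
      by (intro proj_Cauchy_add proj_Cauchy_scaleC proj_Cauchy_const assms)
    have "abs_ptensor ?Y = of_tensor (X n) + (-1) *\<^sub>C abs_ptensor X"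
      unfolding of_tensor_def
        scaleC_ptensor.abs_eq[OF ptensor_eq_refl[OF assms]]
        plus_ptensor.abs_eq[OF ptensor_eq_refl[OF proj_Cauchy_const]
          ptensor_eq_refl[OF proj_Cauchy_scaleC[OF assms]]] ..
    then have "of_tensor (X n) - abs_ptensor X = abs_ptensor ?Y"
      by (simp only: minus_ptensor_def uminus_ptensor_def)
    then have "norm (of_tensor (X n) - abs_ptensor X) = lim (\<lambda>k. proj_norm (?Y k))"
      using Y by (simp add: norm_ptensor.abs_eq ptensor_eq_refl)
    also have "\<dots> \<le> e / 2"
      using N that
      by (intro LIMSEQ_le_const2[OF proj_Cauchy_norm[OF Y]]) (auto intro!: exI[of _ N] less_imp_le)
    finally show ?thesis using \<open>0 < e\<close> by simp
  qed
  then show "\<exists>N. \<forall>n\<ge>N. norm (of_tensor (X n) - abs_ptensor X) < e" by blast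
qed

lemma abs_rep_ptensor: "x = abs_ptensor (rep_ptensor x)"
  by (rule Quotient3_abs_rep[OF Quotient3_ptensor, symmetric])

lemma proj_Cauchy_rep_ptensor: "proj_Cauchy (rep_ptensor x)"
  using Quotient3_rep_reflp[OF Quotient3_ptensor, of x] by (simp add: ptensor_eq_def)

lemma ptensor_cases:
  obtains X where "proj_Cauchy X" "x = abs_ptensor X"
  using abs_rep_ptensor proj_Cauchy_rep_ptensor by metis

instance ptensor :: (complex_normed_vector, complex_normed_vector) complex_banach
proof
  fix x :: "nat \<Rightarrow> ('a, 'b) ptensor"
  assume x: "Cauchy x"
  have "\<exists>u. norm (of_tensor u - x n) < inverse (real (Suc n))" for n
  proof -
    obtain X where "proj_Cauchy X" "x n = abs_ptensor X" by (rule ptensor_cases)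
    then have "(\<lambda>k. of_tensor (X k)) \<longlonglongrightarrow> x n" using of_tensor_LIMSEQ by simp
    moreover have "0 < inverse (real (Suc n))" by simp
    ultimately obtain N where "\<forall>k\<ge>N. norm (of_tensor (X k) - x n) < inverse (real (Suc n))"
      using LIMSEQ_D by blast
    then show ?thesis by blast
  qed
  then obtain U where U: "\<And>n. norm (of_tensor (U n) - x n) < inverse (real (Suc n))" by metis
  have null: "(\<lambda>n. of_tensor (U n) - x n) \<longlonglongrightarrow> 0"
    by (rule Lim_null_comparison[OF _ LIMSEQ_inverse_real_of_nat])
      (intro always_eventually allI less_imp_le U)
  have "Cauchy (\<lambda>n. of_tensor (U n))"
  proof (rule CauchyI)
    fix e :: real assume "0 < e"
    then have e: "0 < e / 2" by simp
    from CauchyD[OF LIMSEQ_imp_Cauchy[OF null] e] obtain M where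
      M: "\<And>m n. m \<ge> M \<Longrightarrow> n \<ge> M \<Longrightarrow>
        norm ((of_tensor (U m) - x m) - (of_tensor (U n) - x n)) < e / 2"
      by blast
    from CauchyD[OF x e] obtain N where
      N: "\<And>m n. m \<ge> N \<Longrightarrow> n \<ge> N \<Longrightarrow> norm (x m - x n) < e / 2"
      by blast
    have "norm (of_tensor (U m) - of_tensor (U n)) < e" if "m \<ge> max M N" "n \<ge> max M N" for m n
      using M[of m n] N[of m n] that
        norm_triangle_ineq[of "(of_tensor (U m) - x m) - (of_tensor (U n) - x n)" "x m - x n"]
      by (simp add: algebra_simps)
    then show "\<exists>N. \<forall>m\<ge>N. \<forall>n\<ge>N. norm (of_tensor (U m) - of_tensor (U n)) < e" by blast
  qed
  then have "proj_Cauchy U"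
    unfolding proj_Cauchy_def Cauchy_def
    by (simp add: dist_norm flip: of_tensor_diff norm_of_tensor)
  then have "(\<lambda>n. of_tensor (U n)) \<longlonglongrightarrow> abs_ptensor U" by (rule of_tensor_LIMSEQ)
  from tendsto_diff[OF this null] have "x \<longlonglongrightarrow> abs_ptensor U" by simp
  then show "convergent x" by (rule convergentI)
qed

definition ptens :: "'a::complex_normed_vector \<Rightarrow> 'b::complex_normed_vector \<Rightarrow> ('a, 'b) ptensor"
    (infixl \<open>\<otimes>\<^sub>p\<close> 70)
  where "a \<otimes>\<^sub>p b = of_tensor (elem_tensor a b)"

definition bounded_cbilinear ::
    "('a::complex_normed_vector \<Rightarrow> 'b::complex_normed_vector \<Rightarrow> 'c::complex_normed_vector) \<Rightarrow> bool"
  where "bounded_cbilinear \<phi> \<longleftrightarrow> bounded_bilinear \<phi> \<and>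
    (\<forall>c a b. \<phi> (c *\<^sub>C a) b = c *\<^sub>C \<phi> a b) \<and> (\<forall>c a b. \<phi> a (c *\<^sub>C b) = c *\<^sub>C \<phi> a b)"

lemma tensor_lift_exists:
  fixes \<phi> :: "'a::complex_normed_vector \<Rightarrow> 'b::complex_normed_vector \<Rightarrow> 'c::complex_normed_vector"
  assumes "bounded_cbilinear \<phi>"
  obtains F :: "('a, 'b) tensor \<Rightarrow> 'c" where
    "\<And>u v. F (u + v) = F u + F v" "\<And>c u. F (c *\<^sub>C u) = c *\<^sub>C F u" "\<And>a b. F (elem_tensor a b) = \<phi> a b"
proof -
  interpret \<phi>: bounded_bilinear \<phi> using assms by (simp add: bounded_cbilinear_def)
  have \<phi>C: "\<phi> (c *\<^sub>C a) b = c *\<^sub>C \<phi> a b" "\<phi> a (c *\<^sub>C b) = c *\<^sub>C \<phi> a b" for c a b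
    using assms by (simp_all add: bounded_cbilinear_def)
  define L :: "(('a \<times> 'b) \<Rightarrow>\<^sub>0 complex) \<Rightarrow> 'c"
    where "L u = (\<Sum>k\<in>Poly_Mapping.keys u. Poly_Mapping.lookup u k *\<^sub>C \<phi> (fst k) (snd k))" for u
  have L_eq: "L u = (\<Sum>k\<in>K. Poly_Mapping.lookup u k *\<^sub>C \<phi> (fst k) (snd k))"
    if "finite K" "Poly_Mapping.keys u \<subseteq> K" for K u
    unfolding L_def using that by (intro sum.mono_neutral_left) (auto simp: in_keys_iff)
  have L_add: "L (u + v) = L u + L v" for u v
  proof -
    let ?K = "Poly_Mapping.keys u \<union> Poly_Mapping.keys v"
    have "Poly_Mapping.keys (u + v) \<subseteq> ?K" by (auto simp: in_keys_iff lookup_add)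
    then show ?thesis
      by (simp add: L_eq[of ?K] lookup_add scaleC_add_left sum.distrib)
  qed
  have L_scale: "L (free_scale c u) = c *\<^sub>C L u" for c u
  proof -
    have "Poly_Mapping.keys (free_scale c u) \<subseteq> Poly_Mapping.keys u" by (auto simp: in_keys_iff)
    then show ?thesis
      by (simp add: L_eq[of "Poly_Mapping.keys u"] complex_vector.scale_sum_right scaleC_scaleC)
  qed
  have L_diff: "L (u - v) = L u - L v" for u v
    using L_add[of "u - v" v] by simp
  have L_gen: "L (gen a b) = \<phi> a b" for a b
    by (simp add: L_eq[of "{(a, b)}"] gen_def)
  have "free.span bilinearity_relations \<subseteq> {u. L u = 0}"
  proof (rule free.span_minimal)
    show "bilinearity_relations \<subseteq> {u. L u = 0}"
      by (auto simp: bilinearity_relations_def L_diff L_add L_scale L_gen \<phi>C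
          \<phi>.add_left \<phi>.add_right)
    show "free.subspace {u. L u = 0}"
      by (rule free.subspaceI) (auto simp: L_add L_scale, simp add: L_def)
  qed
  then have L_cong: "L u = L v" if "tensor_eq u v" for u v
    using that by (auto simp: tensor_eq_def L_diff)
  define F where "F u = L (rep_tensor u)" for u
  have F_abs: "F (abs_tensor z) = L z" for z
    unfolding F_def
    by (rule L_cong, rule Quotient3_rep_abs[OF Quotient3_tensor])
      (rule equivp_reflp[OF equivp_tensor_eq])
  have abs: "\<exists>z. u = abs_tensor z" for u :: "('a, 'b) tensor"
    using Quotient3_abs_rep[OF Quotient3_tensor] by metis
  show ?thesis
  proof
    fix u v :: "('a, 'b) tensor" and c a b
    obtain y z where "u = abs_tensor y" "v = abs_tensor z" using abs by meson
    then show "F (u + v) = F u + F v" "F (c *\<^sub>C u) = c *\<^sub>C F u"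
      by (simp_all add: plus_tensor.abs_eq scaleC_tensor.abs_eq F_abs L_add L_scale)
    show "F (elem_tensor a b) = \<phi> a b"
      by (simp add: elem_tensor.abs_eq F_abs L_gen)
  qed
qed

lemma ptensor_eqI:
  fixes S T :: "('a::complex_normed_vector, 'b::complex_normed_vector) ptensor \<Rightarrow>\<^bsub>CL\<^esub> 'c::complex_normed_vector"
  assumes "\<And>a b. S *\<^sub>V (a \<otimes>\<^sub>p b) = T *\<^sub>V (a \<otimes>\<^sub>p b)"
  shows "S = T"
proof (rule cblinfun_eqI)
  fix x :: "('a, 'b) ptensor"
  interpret S: bounded_linear "cblinfun_apply S" by (rule bounded_linear_cblinfun_apply)
  interpret T: bounded_linear "cblinfun_apply T" by (rule bounded_linear_cblinfun_apply)
  have "S *\<^sub>V (of_tensor (list_tensor ps)) = T *\<^sub>V (of_tensor (list_tensor ps))" for ps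
    using assms
    by (induction ps)
      (auto simp: list_tensor_def of_tensor_add S.add T.add S.zero T.zero ptens_def)
  then have eq: "S *\<^sub>V (of_tensor u) = T *\<^sub>V (of_tensor u)" for u
    using ex_list_tensor[of u] by auto
  obtain X where X: "proj_Cauchy X" "x = abs_ptensor X" by (rule ptensor_cases)
  then have "(\<lambda>n. of_tensor (X n)) \<longlonglongrightarrow> x" using of_tensor_LIMSEQ by simp
  from S.tendsto[OF this] T.tendsto[OF this] show "S *\<^sub>V x = T *\<^sub>V x"
    by (simp add: eq LIMSEQ_unique)
qed

lemma ptensor_lift_exists:
  fixes \<phi> :: "'a::complex_normed_vector \<Rightarrow> 'b::complex_normed_vector \<Rightarrow> 'c::complex_banach"
  assumes "bounded_cbilinear \<phi>"
  shows "\<exists>T. \<forall>a b. T *\<^sub>V (a \<otimes>\<^sub>p b) = \<phi> a b"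
proof -
  interpret \<phi>: bounded_bilinear \<phi> using assms by (simp add: bounded_cbilinear_def)
  obtain K where K: "0 \<le> K" "\<And>a b. norm (\<phi> a b) \<le> norm a * norm b * K"
    using \<phi>.nonneg_bounded by blast
  obtain F :: "('a, 'b) tensor \<Rightarrow> 'c" where F_add: "\<And>u v. F (u + v) = F u + F v"
    and F_scaleC: "\<And>c u. F (c *\<^sub>C u) = c *\<^sub>C F u" and F_elem: "\<And>a b. F (elem_tensor a b) = \<phi> a b"
    using tensor_lift_exists[OF assms] by blast
  have F_diff: "F (u - v) = F u - F v" for u v
    using F_add[of "u - v" v] by simp
  have F_zero: "F 0 = 0" using F_add[of 0 0] by simp
  have F_list: "norm (F (list_tensor ps)) \<le> K * list_cost ps" for ps
  proof (induction ps)
    case Nil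
    then show ?case by (simp add: list_tensor_def list_cost_def F_zero)
  next
    case (Cons p ps)
    obtain a b where p: "p = (a, b)" by (cases p)
    have "norm (F (list_tensor (p # ps))) \<le> norm (\<phi> a b) + norm (F (list_tensor ps))"
      by (simp add: p list_tensor_def F_add F_elem norm_triangle_ineq)
    also have "\<dots> \<le> norm a * norm b * K + K * list_cost ps"
      by (intro add_mono K Cons)
    finally show ?case by (simp add: p list_cost_def algebra_simps)
  qed
  have F_norm: "norm (F u) \<le> K * proj_norm u" for u
  proof (rule field_le_epsilon)
    fix e :: real assume "0 < e"
    then have "proj_norm u < proj_norm u + e / (K + 1)" using K(1) by simp
    then obtain ps where ps: "u = list_tensor ps" "list_cost ps < proj_norm u + e / (K + 1)"
      by (rule proj_norm_approx)
    have "norm (F u) \<le> K * list_cost ps" using F_list ps(1) by simp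
    also have "\<dots> \<le> K * (proj_norm u + e / (K + 1))"
      using ps(2) K(1) by (intro mult_left_mono) auto
    also have "\<dots> = K * proj_norm u + e * (K / (K + 1))" by (simp add: algebra_simps)
    also have "e * (K / (K + 1)) \<le> e * 1"
      using \<open>0 < e\<close> K(1) by (intro mult_left_mono) auto
    finally show "norm (F u) \<le> K * proj_norm u + e" by simp
  qed
  have F_Cauchy: "Cauchy (\<lambda>n. F (X n))" if X: "proj_Cauchy X" for X
  proof (rule CauchyI)
    fix e :: real assume "0 < e"
    then have "0 < e / (K + 1)" using K(1) by simp
    then obtain N where N: "\<forall>m\<ge>N. \<forall>n\<ge>N. proj_norm (X m - X n) < e / (K + 1)"
      using X unfolding proj_Cauchy_def by meson
    have "norm (F (X m) - F (X n)) < e" if "m \<ge> N" "n \<ge> N" for m n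
    proof -
      have "norm (F (X m) - F (X n)) \<le> K * proj_norm (X m - X n)"
        using F_norm[of "X m - X n"] by (simp add: F_diff)
      also have "\<dots> \<le> (K + 1) * proj_norm (X m - X n)"
        by (intro mult_right_mono) (auto simp: proj_norm_nonneg)
      also have "\<dots> < (K + 1) * (e / (K + 1))"
        using N that K(1) by (intro mult_strict_left_mono) auto
      finally show ?thesis using K(1) by simp
    qed
    then show "\<exists>N. \<forall>m\<ge>N. \<forall>n\<ge>N. norm (F (X m) - F (X n)) < e" by blast
  qed
  define T where "T x = lim (\<lambda>n. F (rep_ptensor x n))" for x
  have T_lim: "(\<lambda>n. F (X n)) \<longlonglongrightarrow> T (abs_ptensor X)" if X: "proj_Cauchy X" for X
  proof -
    let ?R = "rep_ptensor (abs_ptensor X)"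
    have "(\<lambda>n. F (?R n)) \<longlonglongrightarrow> T (abs_ptensor X)"
      unfolding T_def using F_Cauchy[OF proj_Cauchy_rep_ptensor]
      by (simp add: Cauchy_convergent_iff convergent_LIMSEQ_iff)
    moreover have "(\<lambda>n. F (X n) - F (?R n)) \<longlonglongrightarrow> 0"
    proof (rule Lim_null_comparison)
      have "ptensor_eq ?R X"
        by (rule Quotient3_rep_abs[OF Quotient3_ptensor, OF ptensor_eq_refl[OF X]])
      then have "(\<lambda>n. K * proj_norm (X n - ?R n)) \<longlonglongrightarrow> K * 0"
        unfolding ptensor_eq_def
        by (intro tendsto_mult tendsto_const) (simp add: proj_norm_minus_commute)
      then show "(\<lambda>n. K * proj_norm (X n - ?R n)) \<longlonglongrightarrow> 0" by simp
      show "\<forall>\<^sub>F n in sequentially. norm (F (X n) - F (?R n)) \<le> K * proj_norm (X n - ?R n)"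
        by (intro always_eventually allI) (metis F_diff F_norm)
    qed
    ultimately show ?thesis by (rule Lim_transform)
  qed
  have T_add: "T (x + y) = T x + T y" for x y
  proof -
    obtain X Y where X: "proj_Cauchy X" "x = abs_ptensor X" and Y: "proj_Cauchy Y" "y = abs_ptensor Y"
      by (metis ptensor_cases)
    then have "x + y = abs_ptensor (\<lambda>n. X n + Y n)"
      by (simp add: plus_ptensor.abs_eq ptensor_eq_refl)
    then have "(\<lambda>n. F (X n) + F (Y n)) \<longlonglongrightarrow> T (x + y)"
      using T_lim[OF proj_Cauchy_add[OF X(1) Y(1)]] by (simp add: F_add)
    moreover have "(\<lambda>n. F (X n) + F (Y n)) \<longlonglongrightarrow> T x + T y"
      using X Y by (auto intro!: tendsto_add T_lim)
    ultimately show ?thesis by (rule LIMSEQ_unique)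
  qed
  have T_scaleC: "T (c *\<^sub>C x) = c *\<^sub>C T x" for c x
  proof -
    obtain X where X: "proj_Cauchy X" "x = abs_ptensor X" by (rule ptensor_cases)
    then have "c *\<^sub>C x = abs_ptensor (\<lambda>n. c *\<^sub>C X n)"
      by (simp add: scaleC_ptensor.abs_eq ptensor_eq_refl)
    then have "(\<lambda>n. c *\<^sub>C F (X n)) \<longlonglongrightarrow> T (c *\<^sub>C x)"
      using T_lim[OF proj_Cauchy_scaleC[OF X(1), of c]] by (simp add: F_scaleC)
    moreover have "(\<lambda>n. c *\<^sub>C F (X n)) \<longlonglongrightarrow> c *\<^sub>C T x"
      using X by (auto intro!: bounded_linear.tendsto[OF bounded_linear_scaleC] T_lim)
    ultimately show ?thesis by (rule LIMSEQ_unique)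
  qed
  have T_norm: "norm (T x) \<le> norm x * K" for x
  proof -
    obtain X where X: "proj_Cauchy X" "x = abs_ptensor X" by (rule ptensor_cases)
    have "norm x = lim (\<lambda>n. proj_norm (X n))"
      using X by (simp add: norm_ptensor.abs_eq ptensor_eq_refl)
    then have "(\<lambda>n. K * proj_norm (X n)) \<longlonglongrightarrow> K * norm x"
      using proj_Cauchy_norm[OF X(1)] by (auto intro!: tendsto_mult)
    moreover have "(\<lambda>n. norm (F (X n))) \<longlonglongrightarrow> norm (T x)"
      using T_lim X by (auto intro!: tendsto_norm)
    ultimately have "norm (T x) \<le> K * norm x"
      by (intro LIMSEQ_le) (auto simp: F_norm)
    then show ?thesis by (simp add: mult.commute)
  qed
  have "bounded_linear T"
  proof (rule bounded_linear_intro[where K = K])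
    show "T (r *\<^sub>R x) = r *\<^sub>R T x" for r x
      using T_scaleC[of "complex_of_real r" x] by (simp add: scaleC_of_real)
  qed (rule T_add T_norm)+
  then have "bounded_clinear T" by (simp add: bounded_clinear_def T_scaleC)
  moreover have "T (a \<otimes>\<^sub>p b) = \<phi> a b" for a b
  proof -
    have "(\<lambda>_. \<phi> a b) \<longlonglongrightarrow> T (a \<otimes>\<^sub>p b)"
      using T_lim[of "\<lambda>_. elem_tensor a b"] by (simp add: F_elem ptens_def of_tensor_def)
    then show ?thesis by (simp add: LIMSEQ_const_iff)
  qed
  ultimately have "\<forall>a b. CBlinfun T *\<^sub>V (a \<otimes>\<^sub>p b) = \<phi> a b"
    by (simp add: CBlinfun_inverse)
  then show ?thesis by blast
qed

text \<open>The description is proper for bounded bilinear \<open>\<phi>\<close>, by the existence lemma above and the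
  uniqueness lemma \<open>ptensor_eqI\<close>.\<close>

definition ptensor_lift ::
    "('a::complex_normed_vector \<Rightarrow> 'b::complex_normed_vector \<Rightarrow> 'c::complex_banach) \<Rightarrow>
     ('a, 'b) ptensor \<Rightarrow>\<^bsub>CL\<^esub> 'c"
  where "ptensor_lift \<phi> = (THE T. \<forall>a b. T *\<^sub>V (a \<otimes>\<^sub>p b) = \<phi> a b)"

lemma ptensor_lift:
  assumes "bounded_cbilinear \<phi>"
  shows "ptensor_lift \<phi> *\<^sub>V (a \<otimes>\<^sub>p b) = \<phi> a b"
proof -
  obtain T where T: "\<forall>a b. T *\<^sub>V (a \<otimes>\<^sub>p b) = \<phi> a b"
    using ptensor_lift_exists[OF assms] by blast
  have "\<forall>a b. ptensor_lift \<phi> *\<^sub>V (a \<otimes>\<^sub>p b) = \<phi> a b"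
    unfolding ptensor_lift_def by (rule theI[of _ T]) (use T in \<open>auto intro!: ptensor_eqI\<close>)
  then show ?thesis by blast
qed

lemma bounded_cbilinear_times:
  "bounded_cbilinear ((*) :: 'a::complex_banach_algebra \<Rightarrow> 'a \<Rightarrow> 'a)"
  by (simp add: bounded_cbilinear_def bounded_bilinear_mult mult_scaleC_left mult_scaleC_right)

lemma bounded_cbilinear_ptens: "bounded_cbilinear (\<otimes>\<^sub>p)"
proof -
  have scaleR: "elem_tensor (r *\<^sub>R a) b = r *\<^sub>R elem_tensor a b"
      "elem_tensor a (r *\<^sub>R b) = r *\<^sub>R elem_tensor a b"
    for r and a :: 'a and b :: 'b
    by (simp_all flip: scaleC_of_real add: elem_tensor_scaleC_left elem_tensor_scaleC_right)
  have of_scaleR: "of_tensor (r *\<^sub>R u) = r *\<^sub>R of_tensor u" for r and u :: "('a, 'b) tensor"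
    by (simp flip: scaleC_of_real add: of_tensor_scaleC)
  have "bounded_bilinear ((\<otimes>\<^sub>p) :: 'a \<Rightarrow> 'b \<Rightarrow> ('a, 'b) ptensor)"
  proof
    show "\<exists>K. \<forall>(a::'a) (b::'b). norm (a \<otimes>\<^sub>p b) \<le> norm a * norm b * K"
      by (rule exI[of _ 1]) (simp add: ptens_def norm_of_tensor proj_norm_elem)
  qed (simp_all add: ptens_def elem_tensor_add_left elem_tensor_add_right of_tensor_add
      scaleR of_scaleR)
  then show ?thesis
    by (simp add: bounded_cbilinear_def ptens_def elem_tensor_scaleC_left
        elem_tensor_scaleC_right of_tensor_scaleC)
qed


section \<open>Banach bimodules\<close>

text \<open>The record holds just the two actions, as families of bounded operators \<open>x \<mapsto> a \<cdot> x\<close> and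
  \<open>x \<mapsto> x \<cdot> a\<close>; the bimodule laws are not part of it.\<close>

record (overloaded) ('a, 'x) bimodule =
  lact :: "'a \<Rightarrow> ('x::complex_normed_vector \<Rightarrow>\<^bsub>CL\<^esub> 'x)"
  ract :: "'a \<Rightarrow> ('x \<Rightarrow>\<^bsub>CL\<^esub> 'x)"

definition dual_bimodule ::
    "('a, 'x::complex_normed_vector) bimodule \<Rightarrow> ('a, 'x dual) bimodule"
  where "dual_bimodule X = \<lparr>lact = \<lambda>a. adjoint (ract X a), ract = \<lambda>a. adjoint (lact X a)\<rparr>"

lemma dual_bimodule_apply:
  "(lact (dual_bimodule X) a *\<^sub>V f) *\<^sub>V x = f *\<^sub>V (ract X a *\<^sub>V x)"
  "(ract (dual_bimodule X) a *\<^sub>V f) *\<^sub>V x = f *\<^sub>V (lact X a *\<^sub>V x)"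
  by (simp_all add: dual_bimodule_def adjoint_apply)

lift_definition left_mult :: "'a::complex_banach_algebra \<Rightarrow> 'a \<Rightarrow>\<^bsub>CL\<^esub> 'a" is "\<lambda>a x. a * x"
  by (simp add: bounded_clinear_def bounded_linear_mult_right mult_scaleC_right)

lift_definition right_mult :: "'a::complex_banach_algebra \<Rightarrow> 'a \<Rightarrow>\<^bsub>CL\<^esub> 'a" is "\<lambda>a x. x * a"
  by (simp add: bounded_clinear_def bounded_linear_mult_left mult_scaleC_left)

definition algebra_bimodule :: "('a::complex_banach_algebra, 'a) bimodule"
  where "algebra_bimodule = \<lparr>lact = left_mult, ract = right_mult\<rparr>"

definition tensor_bimodule :: "('a::complex_banach_algebra, ('a, 'a) ptensor) bimodule"
  where "tensor_bimodule =
    \<lparr>lact = \<lambda>a. ptensor_lift (\<lambda>b c. (a * b) \<otimes>\<^sub>p c),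
     ract = \<lambda>a. ptensor_lift (\<lambda>b c. b \<otimes>\<^sub>p (c * a))\<rparr>"

lemma tensor_bimodule_apply:
  fixes a b c :: "'a::complex_banach_algebra"
  shows "lact tensor_bimodule a *\<^sub>V (b \<otimes>\<^sub>p c) = (a * b) \<otimes>\<^sub>p c"
    and "ract tensor_bimodule a *\<^sub>V (b \<otimes>\<^sub>p c) = b \<otimes>\<^sub>p (c * a)"
proof -
  interpret P: bounded_bilinear "(\<otimes>\<^sub>p) :: 'a \<Rightarrow> 'a \<Rightarrow> ('a, 'a) ptensor"
    using bounded_cbilinear_ptens bounded_cbilinear_def by blast
  have C: "(k *\<^sub>C x) \<otimes>\<^sub>p y = k *\<^sub>C (x \<otimes>\<^sub>p y)" "x \<otimes>\<^sub>p (k *\<^sub>C y) = k *\<^sub>C (x \<otimes>\<^sub>p y)"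
    for k and x y :: 'a
    using bounded_cbilinear_ptens unfolding bounded_cbilinear_def by blast+
  have "bounded_cbilinear (\<lambda>b (c::'a). (a * b) \<otimes>\<^sub>p c)"
    unfolding bounded_cbilinear_def
    using P.comp[OF bounded_linear_mult_right[of a] bounded_linear_ident]
    by (simp add: mult_scaleC_right C)
  then show "lact tensor_bimodule a *\<^sub>V (b \<otimes>\<^sub>p c) = (a * b) \<otimes>\<^sub>p c"
    by (simp add: tensor_bimodule_def ptensor_lift)
  have "bounded_cbilinear (\<lambda>(b::'a) c. b \<otimes>\<^sub>p (c * a))"
    unfolding bounded_cbilinear_def
    using P.comp[OF bounded_linear_ident bounded_linear_mult_left[of a]]
    by (simp add: mult_scaleC_left C)
  then show "ract tensor_bimodule a *\<^sub>V (b \<otimes>\<^sub>p c) = b \<otimes>\<^sub>p (c * a)"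
    by (simp add: tensor_bimodule_def ptensor_lift)
qed

definition diagonal_op :: "('a::complex_banach_algebra, 'a) ptensor \<Rightarrow>\<^bsub>CL\<^esub> 'a"
  where "diagonal_op = ptensor_lift (*)"

lemma diagonal_op_apply: "diagonal_op *\<^sub>V (a \<otimes>\<^sub>p b) = a * b"
  by (simp add: diagonal_op_def ptensor_lift bounded_cbilinear_times)


section \<open>Biflatness and virtual diagonals twisted by a homomorphism\<close>

text \<open>Continuity and complex linearity are part of the operator type.\<close>

definition Hom :: "('a::complex_banach_algebra \<Rightarrow>\<^bsub>CL\<^esub> 'a) set"
  where "Hom = {\<sigma>. \<forall>a b. \<sigma> *\<^sub>V (a * b) = (\<sigma> *\<^sub>V a) * (\<sigma> *\<^sub>V b)}"

text \<open>Nets are rendered as families along a filter; for a net indexed by a directed set, \<open>F\<close> is the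
  filter generated by the tails of the index set.\<close>

definition bounded_approximate_identity ::
    "('i \<Rightarrow> 'a::complex_banach_algebra) \<Rightarrow> 'i filter \<Rightarrow> bool"
  where "bounded_approximate_identity e F \<longleftrightarrow> F \<noteq> bot \<and> (\<exists>K. \<forall>i. norm (e i) \<le> K) \<and>
    (\<forall>a. ((\<lambda>i. e i * a) \<longlongrightarrow> a) F \<and> ((\<lambda>i. a * e i) \<longlongrightarrow> a) F)"

definition sigma_biflat :: "('a::complex_banach_algebra \<Rightarrow>\<^bsub>CL\<^esub> 'a) \<Rightarrow> bool"
  where "sigma_biflat \<sigma> \<longleftrightarrow>
    (\<exists>\<rho> :: ('a, 'a) ptensor dual \<Rightarrow>\<^bsub>CL\<^esub> 'a dual.
      (\<forall>a f. \<rho> *\<^sub>V (lact (dual_bimodule tensor_bimodule) (\<sigma> *\<^sub>V a) *\<^sub>V f) =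
         lact (dual_bimodule algebra_bimodule) a *\<^sub>V (\<rho> *\<^sub>V f)) \<and>
      (\<forall>a f. \<rho> *\<^sub>V (ract (dual_bimodule tensor_bimodule) (\<sigma> *\<^sub>V a) *\<^sub>V f) =
         ract (dual_bimodule algebra_bimodule) a *\<^sub>V (\<rho> *\<^sub>V f)) \<and>
      \<rho> o\<^sub>C adjoint diagonal_op = adjoint \<sigma>)"

definition sigma_virtual_diagonal ::
    "('a::complex_banach_algebra \<Rightarrow>\<^bsub>CL\<^esub> 'a) \<Rightarrow> ('a, 'a) ptensor dual dual \<Rightarrow> bool"
  where "sigma_virtual_diagonal \<sigma> M \<longleftrightarrow>
    (\<forall>a. lact (dual_bimodule (dual_bimodule tensor_bimodule)) (\<sigma> *\<^sub>V a) *\<^sub>V M =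
         ract (dual_bimodule (dual_bimodule tensor_bimodule)) (\<sigma> *\<^sub>V a) *\<^sub>V M) \<and>
    (\<forall>a. ract (dual_bimodule (dual_bimodule algebra_bimodule)) (\<sigma> *\<^sub>V a) *\<^sub>V
           (adjoint (adjoint diagonal_op) *\<^sub>V M) = bidual_embedding (\<sigma> *\<^sub>V a))"

end

theory Submission
  imports Defs
begin

text \<open>A virtual diagonal is obtained by pushing an approximate identity through the adjoint of the
  splitting map. By weak-star compactness (\<open>bounded_family_weak_star_limit\<close>), the bounded
  approximate identity \<open>e\<close> has, along a finer filter, a weak-star limit \<open>E\<close> in the bidual of the
  algebra. If \<open>\<rho>\<close> witnesses \<open>\<sigma>\<close>-biflatness, let \<open>M = \<rho>\<^sup>*(E)\<close>, so that \<open>M(f)\<close> is the limit of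
  \<open>\<rho>(f)(e\<^sub>i)\<close>.

  The equivariance of \<open>\<rho>\<close> turns \<open>(\<sigma>(a) \<cdot> M)(f)\<close> and \<open>(M \<cdot> \<sigma>(a))(f)\<close> into the limits of
  \<open>\<rho>(f)(a e\<^sub>i)\<close> and \<open>\<rho>(f)(e\<^sub>i a)\<close>, both of which are \<open>\<rho>(f)(a)\<close>. The identity
  \<open>\<rho> \<circ> \<pi>\<^sup>* = \<sigma>\<^sup>*\<close> turns \<open>(\<pi>\<^sup>*\<^sup>*(M) \<cdot> \<sigma>(a))(g)\<close> into the limit of
  \<open>g(\<sigma>(e\<^sub>i) \<sigma>(a)) = g(\<sigma>(e\<^sub>i a))\<close>, which is \<open>g(\<sigma>(a))\<close>.\<close>

text \<open>The Banach--Alaoglu theorem for the canonical image of a bounded family: the evaluations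
  \<open>f \<mapsto> f (x i)\<close> stay in a product of closed discs, which is compact by Tychonoff's theorem, and
  a pointwise limit of them is again linear and bounded. A cluster point is expressed as a limit
  along a finer filter.\<close>

lemma bounded_family_weak_star_limit:
  fixes x :: "'i \<Rightarrow> 'a::complex_normed_vector"
  assumes "F \<noteq> bot" and bound: "\<And>i. norm (x i) \<le> K"
  obtains G and E :: "'a dual dual" where "G \<noteq> bot" "G \<le> F" "\<And>f. ((\<lambda>i. f *\<^sub>V x i) \<longlongrightarrow> E *\<^sub>V f) G"
proof -
  define ev :: "'i \<Rightarrow> 'a dual \<Rightarrow> complex" where "ev i f = f *\<^sub>V x i" for i f
  define B :: "('a dual \<Rightarrow> complex) set" where "B = (\<Pi>\<^sub>E f\<in>UNIV. cball 0 (norm f * K))"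
  have ev_bound: "norm (ev i f) \<le> norm f * K" for i f
    unfolding ev_def using norm_cblinfun[of f "x i"] mult_left_mono[OF bound[of i], of "norm f"]
    by simp
  have "compactin (product_topology (\<lambda>f::'a dual. euclidean) UNIV) B"
    unfolding B_def by (simp add: compactin_PiE)
  then have "compact B"
    by (simp add: euclidean_product_topology)
  moreover have "eventually (\<lambda>T. T \<in> B) (filtermap ev F)"
    using ev_bound by (auto simp: eventually_filtermap B_def intro!: always_eventually)
  moreover have "filtermap ev F \<noteq> bot"
    using \<open>F \<noteq> bot\<close> by (simp add: filtermap_bot_iff)
  ultimately obtain T where T: "inf (nhds T) (filtermap ev F) \<noteq> bot"
    unfolding compact_filter by blast
  define G where "G = inf F (filtercomap ev (nhds T))"
  have "G \<noteq> bot"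
  proof
    assume "G = bot"
    then obtain P Q where PQ: "eventually P F" "eventually Q (nhds T)" "\<And>i. P i \<Longrightarrow> \<not> Q (ev i)"
      unfolding G_def trivial_limit_def eventually_inf eventually_filtercomap by metis
    have "eventually (\<lambda>T. \<not> Q T) (filtermap ev F)"
      using PQ by (auto simp: eventually_filtermap elim: eventually_mono)
    with PQ(2) have "inf (nhds T) (filtermap ev F) = bot"
      unfolding trivial_limit_def eventually_inf by blast
    with T show False by contradiction
  qed
  have "filterlim ev (nhds T) G"
    unfolding G_def by (meson filterlim_filtercomap filterlim_mono inf_le2 order_refl)
  then have lim: "((\<lambda>i. f *\<^sub>V x i) \<longlongrightarrow> T f) G" for f
    using continuous_on_tendsto_compose[OF continuous_on_product_coordinates[of f], of ev T G]
    by (simp add: ev_def)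
  have lim_eq: "T f = l" if "((\<lambda>i. f *\<^sub>V x i) \<longlongrightarrow> l) G" for f l
    using tendsto_unique[OF \<open>G \<noteq> bot\<close> lim that] .
  have T_scaleC: "T (c *\<^sub>C f) = c *\<^sub>C T f" for c f
    by (rule lim_eq) (auto simp: scaleC_cblinfun.rep_eq
        intro: bounded_linear.tendsto[OF bounded_linear_scaleC] lim)
  have "bounded_linear T"
  proof (rule bounded_linear_intro[where K = K])
    show "T (f + g) = T f + T g" for f g
      by (rule lim_eq) (auto simp: plus_cblinfun.rep_eq intro: tendsto_add lim)
    show "T (r *\<^sub>R f) = r *\<^sub>R T f" for r f
      using T_scaleC[of "complex_of_real r" f] by (simp add: scaleC_of_real)
    show "norm (T f) \<le> norm f * K" for f
      using ev_bound[of _ f] \<open>G \<noteq> bot\<close>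
      by (intro tendsto_upperbound[OF tendsto_norm[OF lim]]) (simp_all add: ev_def)
  qed
  then have "cblinfun_apply (CBlinfun T) = T"
    by (simp add: CBlinfun_inverse bounded_clinear_def T_scaleC)
  with lim have "((\<lambda>i. f *\<^sub>V x i) \<longlongrightarrow> CBlinfun T *\<^sub>V f) G" for f
    by simp
  moreover have "G \<le> F" by (simp add: G_def)
  ultimately show thesis using that \<open>G \<noteq> bot\<close> by blast
qed

theorem proposition3p1:
  fixes \<sigma> :: "'a::complex_banach_algebra \<Rightarrow>\<^bsub>CL\<^esub> 'a"
    and e :: "'i \<Rightarrow> 'a" and F :: "'i filter"
  assumes "bounded_approximate_identity e F"
    and "\<sigma> \<in> Hom"
    and "sigma_biflat \<sigma>"
  shows "\<exists>M. sigma_virtual_diagonal \<sigma> M"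
proof -
  let ?A = "algebra_bimodule :: ('a, 'a) bimodule"
  let ?T = "tensor_bimodule :: ('a, ('a, 'a) ptensor) bimodule"
  obtain K where "F \<noteq> bot" "\<And>i. norm (e i) \<le> K"
    and e_left: "\<And>a. ((\<lambda>i. e i * a) \<longlongrightarrow> a) F" and e_right: "\<And>a. ((\<lambda>i. a * e i) \<longlongrightarrow> a) F"
    using assms(1) unfolding bounded_approximate_identity_def by blast
  then obtain G and E :: "'a dual dual" where "G \<noteq> bot" "G \<le> F" and E: "\<And>f. ((\<lambda>i. f *\<^sub>V e i) \<longlongrightarrow> E *\<^sub>V f) G"
    by (metis bounded_family_weak_star_limit)
  obtain \<rho> :: "('a, 'a) ptensor dual \<Rightarrow>\<^bsub>CL\<^esub> 'a dual" where
    \<rho>_left: "\<And>a f. \<rho> *\<^sub>V (lact (dual_bimodule ?T) (\<sigma> *\<^sub>V a) *\<^sub>V f) = lact (dual_bimodule ?A) a *\<^sub>V (\<rho> *\<^sub>V f)"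
    and \<rho>_right: "\<And>a f. \<rho> *\<^sub>V (ract (dual_bimodule ?T) (\<sigma> *\<^sub>V a) *\<^sub>V f) = ract (dual_bimodule ?A) a *\<^sub>V (\<rho> *\<^sub>V f)"
    and "\<rho> o\<^sub>C adjoint diagonal_op = adjoint \<sigma>"
    using assms(3) unfolding sigma_biflat_def by blast
  then have \<rho>_diagonal: "\<rho> *\<^sub>V (adjoint diagonal_op *\<^sub>V g) = adjoint \<sigma> *\<^sub>V g" for g
    by (metis cblinfun_compose_apply)
  have hom: "\<sigma> *\<^sub>V (a * b) = (\<sigma> *\<^sub>V a) * (\<sigma> *\<^sub>V b)" for a b
    using assms(2) by (simp add: Hom_def)
  have act: "(lact (dual_bimodule ?A) a *\<^sub>V f) *\<^sub>V x = f *\<^sub>V (x * a)"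
      "(ract (dual_bimodule ?A) a *\<^sub>V f) *\<^sub>V x = f *\<^sub>V (a * x)" for a x and f :: "'a dual"
    by (simp_all add: dual_bimodule_apply algebra_bimodule_def left_mult.rep_eq right_mult.rep_eq)
  have E_eq: "E *\<^sub>V f = l" if "((\<lambda>i. f *\<^sub>V e i) \<longlongrightarrow> l) F" for f l
    using tendsto_unique[OF \<open>G \<noteq> bot\<close> E tendsto_mono[OF \<open>G \<le> F\<close> that]] .
  have E_left: "E *\<^sub>V (lact (dual_bimodule ?A) a *\<^sub>V f) = f *\<^sub>V a" for a f
    by (rule E_eq) (simp add: act bounded_linear.tendsto[OF bounded_linear_cblinfun_apply e_left])
  have E_right: "E *\<^sub>V (ract (dual_bimodule ?A) a *\<^sub>V f) = f *\<^sub>V a" for a f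
    by (rule E_eq) (simp add: act bounded_linear.tendsto[OF bounded_linear_cblinfun_apply e_right])
  have E_hom: "E *\<^sub>V (adjoint \<sigma> *\<^sub>V (lact (dual_bimodule ?A) (\<sigma> *\<^sub>V a) *\<^sub>V g)) = g *\<^sub>V (\<sigma> *\<^sub>V a)" for a g
    by (rule E_eq) (simp add: adjoint_apply act flip: hom,
        intro bounded_linear.tendsto[OF bounded_linear_cblinfun_apply] e_left)
  have "sigma_virtual_diagonal \<sigma> (adjoint \<rho> *\<^sub>V E)"
    unfolding sigma_virtual_diagonal_def
  proof (intro conjI allI cblinfun_eqI)
    fix a and f :: "('a, 'a) ptensor dual"
    show "(lact (dual_bimodule (dual_bimodule ?T)) (\<sigma> *\<^sub>V a) *\<^sub>V adjoint \<rho> *\<^sub>V E) *\<^sub>V f =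
        (ract (dual_bimodule (dual_bimodule ?T)) (\<sigma> *\<^sub>V a) *\<^sub>V adjoint \<rho> *\<^sub>V E) *\<^sub>V f"
      by (simp add: dual_bimodule_apply(1,2)[of "dual_bimodule ?T"] adjoint_apply
          \<rho>_left \<rho>_right E_left E_right)
  next
    fix a and g :: "'a dual"
    show "(ract (dual_bimodule (dual_bimodule ?A)) (\<sigma> *\<^sub>V a) *\<^sub>V
        adjoint (adjoint diagonal_op) *\<^sub>V adjoint \<rho> *\<^sub>V E) *\<^sub>V g = bidual_embedding (\<sigma> *\<^sub>V a) *\<^sub>V g"
      by (simp add: dual_bimodule_apply(2)[of "dual_bimodule ?A"] adjoint_apply
          \<rho>_diagonal E_hom bidual_embedding_apply)
  qed
  then show ?thesis by blast
qed

end
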